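(* Fix $t\in\mathbb{C}$ and put $s_0=t^2/2-2$. (a) Let $\mathsf{s}_{ij}\in\mathbb{C}$ ($1\le i,j\le 3$) with $\mathsf{s}_{ij}=\mathsf{s}_{ji}$ and $\mathsf{s}_{ii}=s_0$ for $1\le i\le 3$, and let $\mathsf{s}_{123}\in\mathbb{C}$ with $\mathsf{s}_{123}\neq0$, be such that $2\mathsf{s}_{123}^2+\det\big((\mathsf{s}_{ij})_{i,j=1}^3\big)=0$. Then, up to simultaneous conjugacy, there exists a unique $(\mathbf{x}_1,\mathbf{x}_2,\mathbf{x}_3)\in G(t)^3$ with $s_{ij}=\mathsf{s}_{ij}$ for all $1\le i,j\le 3$ and $s_{123}=\mathsf{s}_{123}$. (b) Suppose $\mathbf{x}_1,\mathbf{x}_2,\mathbf{x}_3\in G(t)$, with $s_{123}=\mathsf{s}_{123}\neq0$ and $s_{ij}=\mathsf{s}_{ij}$ for $1\le i,j\le3$. Let $\mathsf{s}_{14},\mathsf{s}_{24},\mathsf{s}_{34},\mathsf{s}_{44}$ and $\mathsf{s}_{124},\mathsf{s}_{134},\mathsf{s}_{234}$ be complex numbers such that $\mathsf{s}_{44}=s_0$ and, with $\mathsf{s}_{4i}:=\mathsf{s}_{i4}$, $$\mathsf{s}_{i1}\mathsf{s}_{234}-\mathsf{s}_{i2}\mathsf{s}_{134}+\mathsf{s}_{i3}\mathsf{s}_{124}-\mathsf{s}_{i4}\mathsf{s}_{123}=0,\qquad 1\le i\le4.$$ Then there exists a unique $\mathbf{x}_4\in G(t)$ with $s_{i4}=\mathsf{s}_{i4}$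 for $1\le i\le 4$ and $s_{ij4}=\mathsf{s}_{ij4}$ for all $1\le i<j\le3$; moreover, $$\check{\mathbf{x}}_4=\frac{\mathsf{s}_{234}}{\mathsf{s}_{123}}\check{\mathbf{x}}_1-\frac{\mathsf{s}_{134}}{\mathsf{s}_{123}}\check{\mathbf{x}}_2+\frac{\mathsf{s}_{124}}{\mathsf{s}_{123}}\check{\mathbf{x}}_3.$$
   Context: $G(t)=\{\mathbf{x}\in{\rm SL}(2,\mathbb{C}):{\rm tr}(\mathbf{x})=t\}$. For a $2\times2$ complex matrix $\mathbf{x}$, $\check{\mathbf{x}}=\mathbf{x}-\tfrac12{\rm tr}(\mathbf{x})\,\mathbf{e}$, where $\mathbf{e}$ is the identity matrix. For matrices $\mathbf{x}_1,\mathbf{x}_2,\ldots$, $s_{i_1\cdots i_r}={\rm tr}(\check{\mathbf{x}}_{i_1}\cdots\check{\mathbf{x}}_{i_r})$. Simultaneous conjugacy means $(\mathbf{x}_1,\mathbf{x}_2,\mathbf{x}_3)\mapsto(\mathbf{a}\mathbf{x}_1\mathbf{a}^{-1},\mathbf{a}\mathbf{x}_2\mathbf{a}^{-1},\mathbf{a}\mathbf{x}_3\mathbf{a}^{-1})$ with $\mathbf{a}\in{\rm SL}(2,\mathbb{C})$. Sans-serif symbols $\mathsf{s}_{\cdots}$ denote prescribed complex numbers, while $s_{\cdots}$ denote the trace functions of the matrices. *)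

theory Defs
  imports "HOL-Analysis.Analysis"
begin

type_synonym cmat2 = "complex^2^2"

definition mscale :: "complex \<Rightarrow> cmat2 \<Rightarrow> cmat2" (infixr "*\<^sub>C" 70) where
  "c *\<^sub>C x = (\<chi> i j. c * x$i$j)"

definition SL2 :: "cmat2 set" where
  "SL2 = {x. det x = 1}"

definition G :: "complex \<Rightarrow> cmat2 set" where
  "G t = {x \<in> SL2. trace x = t}"

definition tracefree :: "cmat2 \<Rightarrow> cmat2" where
  "tracefree x = x - (trace x / 2) *\<^sub>C mat 1"

(* The trace function s with indices i_1, ..., i_r of a family x is
   tftrace [x i_1, ..., x i_r]. *)
definition tftrace :: "cmat2 list \<Rightarrow> complex" where
  "tftrace xs = trace (foldr (\<lambda>x p. tracefree x ** p) xs (mat 1))"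

definition sim_conj :: "cmat2^3 \<Rightarrow> cmat2^3 \<Rightarrow> bool" where
  "sim_conj x y \<longleftrightarrow> (\<exists>a\<in>SL2. \<forall>i. y$i = a ** x$i ** matrix_inv a)"

(* Indices range over the type 3, whose elements are 1, 2 and 3. *)
definition realizes :: "complex \<Rightarrow> complex^3^3 \<Rightarrow> complex \<Rightarrow> cmat2^3 \<Rightarrow> bool" where
  "realizes t S s123 x \<longleftrightarrow>
     (\<forall>i. x$i \<in> G t) \<and>
     (\<forall>i j. tftrace [x$i, x$j] = S$i$j) \<and>
     tftrace [x$1, x$2, x$3] = s123"

end

(* On trace-free 2x2 matrices the trace form is a symmetric bilinear form and tr(XYZ) is an
   alternating trilinear form. Cramer's rule therefore reads
     tr(A1 A2 A3) Z = tr(Z A2 A3) A1 + tr(Z A3 A1) A2 + tr(Z A1 A2) A3,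
   which gives part (b) at once. For existence in (a) a trace-free triple with the prescribed Gram
   matrix is written down explicitly; 2 tr(A1 A2 A3)^2 + det(Gram) = 0 fixes tr(A1 A2 A3) up to
   sign, and replacing A by -A corrects the sign. For uniqueness, the linear map sending one triple
   to the other preserves both forms, so it sends the standard basis H, E, F of sl2 to matrices
   H', E', F' with the same products; a nonzero column u of E' then yields the conjugating matrix
   with columns u and F' u. *)
theory Submission
  imports Defs
begin

section \<open>Coordinates with respect to a triple of trace-free matrices\<close>

lemmas mat2_simps = vec_eq_iff forall_2 trace_def matrix_matrix_mult_def sum_2 mscale_def mat_def

definition comb :: "complex^3 \<Rightarrow> cmat2^3 \<Rightarrow> cmat2" where
  "comb p A = p$1 *\<^sub>C A$1 + p$2 *\<^sub>C A$2 + p$3 *\<^sub>C A$3"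

text \<open>Cramer quotients: each numerator is \<open>trace (A$1 ** A$2 ** A$3)\<close> with one
  factor replaced by \<open>Z\<close>, rotated cyclically to put \<open>Z\<close> first.\<close>

definition coord :: "cmat2^3 \<Rightarrow> cmat2 \<Rightarrow> complex^3" where
  "coord A Z = (1 / trace (A$1 ** A$2 ** A$3)) *s
     vector [trace (Z ** A$2 ** A$3), trace (Z ** A$3 ** A$1), trace (Z ** A$1 ** A$2)]"

lemma tracefree_entry: "trace (A::cmat2) = 0 \<Longrightarrow> A$2$2 = - A$1$1"
  by (simp add: trace_def sum_2 eq_neg_iff_add_eq_0 add.commute)

text \<open>Cramer's rule in the three-dimensional space of trace-free matrices, with the triple
  trace in the role of the determinant.\<close>

lemma comb_coord:
  assumes A: "\<forall>i. trace (A$i) = 0" and "trace Z = 0"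
    and s: "trace (A$1 ** A$2 ** A$3) \<noteq> 0"
  shows "comb (coord A Z) A = Z"
proof -
  note e = tracefree_entry[OF A[rule_format, of 1]] tracefree_entry[OF A[rule_format, of 2]]
     tracefree_entry[OF A[rule_format, of 3]] tracefree_entry[OF \<open>trace Z = 0\<close>]
  have "trace (Z ** A$2 ** A$3) *\<^sub>C A$1 + trace (Z ** A$3 ** A$1) *\<^sub>C A$2
     + trace (Z ** A$1 ** A$2) *\<^sub>C A$3 = trace (A$1 ** A$2 ** A$3) *\<^sub>C Z"
    by (simp add: mat2_simps e algebra_simps)
  then show ?thesis using s
    by (simp add: comb_def coord_def mscale_def vec_eq_iff divide_simps mult_ac)
qed

lemma trace_comb:
  "trace (comb p A ** comb q A) = (\<Sum>i\<in>UNIV. \<Sum>j\<in>UNIV. p$i * q$j * trace (A$i ** A$j))"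
  by (simp add: comb_def mat2_simps sum_3 algebra_simps)

text \<open>The triple trace is an alternating trilinear form on a three-dimensional space, so it
  scales by the determinant of the coordinates.\<close>

lemma trace_comb3:
  assumes A: "\<forall>i. trace (A$i) = 0"
  shows "trace (comb p A ** comb q A ** comb r A)
     = det (vector [p, q, r] :: complex^3^3) * trace (A$1 ** A$2 ** A$3)"
proof -
  note e = tracefree_entry[OF A[rule_format, of 1]] tracefree_entry[OF A[rule_format, of 2]]
     tracefree_entry[OF A[rule_format, of 3]]
  show ?thesis by (simp add: comb_def mat2_simps det_3 e) algebra
qed

text \<open>If \<open>C\<close> holds the coordinates of the triple in the standard basis H, E, F of
  sl2, then the triple trace is det C, since tr(HEF) = 1. The Gram determinant of H, E, F is -2, so
  that of the triple is -2 (det C)^2.\<close>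

lemma gram_det_tracefree:
  fixes A :: "cmat2^3"
  assumes A: "\<forall>i. trace (A$i) = 0"
  shows "2 * trace (A$1 ** A$2 ** A$3)^2 + det (\<chi> i j. trace (A$i ** A$j) :: complex^3^3) = 0"
proof -
  note e = tracefree_entry[OF A[rule_format, of 1]] tracefree_entry[OF A[rule_format, of 2]]
     tracefree_entry[OF A[rule_format, of 3]]
  show ?thesis by (simp add: mat2_simps det_3 e) algebra
qed

section \<open>The multiplication table of sl2 and its standard representation\<close>

text \<open>Cayley-Hamilton; the scalar equals \<open>- det A\<close>. The next lemma is its
  polarization.\<close>

lemma tracefree_sq: "trace A = 0 \<Longrightarrow> A ** A = (trace (A ** A) / 2) *\<^sub>C mat 1"
  using tracefree_entry[of A] by (simp add: mat2_simps algebra_simps)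

lemma tracefree_anticomm: "trace A = 0 \<Longrightarrow> trace B = 0 \<Longrightarrow>
   A ** B + B ** A = trace (A ** B) *\<^sub>C mat 1"
  using tracefree_entry[of A] tracefree_entry[of B] by (simp add: mat2_simps algebra_simps)

lemma mat2_diff: "A ** (B - C) = A ** B - A ** C" "(A - B) ** C = A ** C - B ** (C::cmat2)"
  by (simp_all add: mat2_simps algebra_simps)

lemma mat2_neg: "A ** (- B) = - (A ** B)" "(- A) ** B = - (A ** (B::cmat2))"
  by (simp_all add: mat2_simps)

lemma mat2_trace_neg: "trace (- A) = - trace (A::cmat2)"
  by (simp add: trace_def sum_2)

text \<open>Squares and anticommutators are scalars read off from the traces. The products
  \<open>H ** E\<close> and \<open>H ** F\<close> are again trace-free, so Cramer's rule expands
  them in the triple itself.\<close>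

lemma sl2_relations:
  fixes H E F :: cmat2
  assumes tr: "trace H = 0" "trace E = 0" "trace F = 0"
    and tr2: "trace (H ** H) = 2" "trace (E ** E) = 0" "trace (F ** F) = 0"
      "trace (H ** E) = 0" "trace (H ** F) = 0" "trace (E ** F) = 1"
    and tr3: "trace (H ** E ** F) = 1"
  shows "H ** H = mat 1" "E ** E = 0" "F ** F = 0" "E ** F + F ** E = mat 1"
    "H ** E = E" "E ** H = - E" "H ** F = - F" "F ** H = F"
proof -
  show HH: "H ** H = mat 1" and EE: "E ** E = 0" and FF: "F ** F = 0"
    using tracefree_sq[OF tr(1)] tracefree_sq[OF tr(2)] tracefree_sq[OF tr(3)]
    by (simp_all add: tr2 mscale_def vec_eq_iff)
  have EH: "E ** H = - (H ** E)" and FH: "F ** H = - (H ** F)"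
    using tracefree_anticomm[OF tr(1,2)] tracefree_anticomm[OF tr(1,3)]
    by (simp_all add: tr2 mscale_def vec_eq_iff eq_neg_iff_add_eq_0 add.commute)
  show EF: "E ** F + F ** E = mat 1"
    using tracefree_anticomm[OF tr(2,3)] by (simp add: tr2 mscale_def vec_eq_iff)
  have FE: "F ** E = mat 1 - E ** F" using EF by (simp add: algebra_simps)
  define A :: "cmat2^3" where "A = vector [H, E, F]"
  have A: "\<forall>i. trace (A$i) = 0" "trace (A$1 ** A$2 ** A$3) \<noteq> 0"
    by (simp_all add: A_def forall_3 tr tr3)
  have tFE: "trace (F ** E) = 1" using tr2 trace_mul_sym by metis
  \<comment> \<open>The products 1, 2 and 3 have as traces the Cramer numerators of
    \<open>H ** E\<close>, namely 0, 1 and 0.\<close>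
  have 1: "(H ** E) ** E ** F = 0"
    by (simp add: EE matrix_mul_assoc[symmetric])
  have "(H ** E) ** F ** H = H ** (E ** (F ** H))" by (simp add: matrix_mul_assoc)
  also have "\<dots> = - (H ** (E ** H) ** F)"
    by (simp add: FH mat2_neg matrix_mul_assoc)
  also have "\<dots> = E ** F"
    by (simp add: EH mat2_neg HH matrix_mul_assoc)
  finally have 2: "(H ** E) ** F ** H = E ** F" .
  have "(H ** E) ** H ** E = H ** (E ** H) ** E" by (simp add: matrix_mul_assoc)
  also have "\<dots> = 0"
    by (simp add: EH mat2_neg HH matrix_mul_assoc EE)
  finally have 3: "(H ** E) ** H ** E = 0" .
  have trace0: "trace (0::cmat2) = 0" by (simp add: trace_def)
  show HE: "H ** E = E"
    using comb_coord[OF A(1) _ A(2), of "H ** E"] 1 2 3 tr2 tr3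
    by (simp add: trace0 comb_def coord_def A_def mscale_def vec_eq_iff)
  \<comment> \<open>Likewise 4, 5 and 6 give the numerators 0, 0 and -1 of
    \<open>H ** F\<close>.\<close>
  have "(H ** F) ** E ** F = H ** (F ** E) ** F" by (simp add: matrix_mul_assoc)
  also have "\<dots> = H ** F - H ** E ** (F ** F)"
    by (simp add: FE mat2_diff matrix_mul_assoc)
  finally have 4: "(H ** F) ** E ** F = H ** F" by (simp add: FF)
  have 5: "(H ** F) ** F ** H = 0"
    by (simp add: FF matrix_mul_assoc[symmetric])
  have "(H ** F) ** H ** E = H ** (F ** H) ** E" by (simp add: matrix_mul_assoc)
  also have "\<dots> = - (F ** E)"
    by (simp add: FH mat2_neg HH matrix_mul_assoc)
  finally have 6: "trace ((H ** F) ** H ** E) = - 1"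
    using tFE by (simp add: mat2_trace_neg)
  show HF: "H ** F = - F"
    using comb_coord[OF A(1) _ A(2), of "H ** F"] 4 5 6 tr2 tr3
    by (simp add: trace0 comb_def coord_def A_def mscale_def vec_eq_iff)
  show "E ** H = - E" "F ** H = F" by (simp_all add: EH HE FH HF)
qed

text \<open>A nonzero column \<open>u\<close> of \<open>E\<close> is a highest weight vector:
  \<open>E\<close> kills it and \<open>H\<close> fixes it. With respect to \<open>u\<close> and
  \<open>F *v u\<close> the three matrices act in standard form.\<close>

lemma sl2_intertwiner:
  fixes H E F :: cmat2
  assumes tr: "trace H = 0" "trace E = 0" "trace F = 0"
    and tr2: "trace (H ** H) = 2" "trace (E ** E) = 0" "trace (F ** F) = 0"
      "trace (H ** E) = 0" "trace (H ** F) = 0" "trace (E ** F) = 1"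
    and tr3: "trace (H ** E ** F) = 1"
  obtains a :: cmat2 where "det a \<noteq> 0"
    "a ** vector [vector [1, 0], vector [0, -1]] = H ** a"
    "a ** vector [vector [0, 1], vector [0, 0]] = E ** a"
    "a ** vector [vector [0, 0], vector [1, 0]] = F ** a"
proof -
  note rel = sl2_relations[OF assms]
  have "\<exists>j. column j E \<noteq> 0"
  proof (rule ccontr)
    assume "\<not> ?thesis"
    then have "E = 0" by (simp add: vec_eq_iff column_def)
    then show False using tr2 by simp
  qed
  then obtain j where j: "column j E \<noteq> 0" by blast
  define u where "u = column j E"
  define v where "v = F *v u"
  have u: "u = E *v axis j 1"
    by (simp add: u_def column_def matrix_vector_mult_def axis_def vec_eq_iff if_distrib cong: if_cong)
  have Eu: "E *v u = 0" by (simp add: u matrix_vector_mul_assoc rel)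
  have Hu: "H *v u = u" by (simp add: u matrix_vector_mul_assoc rel)
  have Fv: "F *v v = 0" by (simp add: v_def matrix_vector_mul_assoc rel)
  have Hv: "H *v v = - v" by (simp add: v_def matrix_vector_mul_assoc rel)
     (simp add: vec_eq_iff matrix_vector_mult_def sum_negf)
  have "E *v v = (E ** F + F ** E) *v u"
    by (simp add: v_def matrix_vector_mul_assoc matrix_vector_mult_add_rdistrib)
      (simp add: Eu matrix_vector_mul_assoc[symmetric])
  then have Ev: "E *v v = u" by (simp add: rel)
  define a :: cmat2 where "a = vector [vector [u$1, v$1], vector [u$2, v$2]]"
  note s = vec_eq_iff forall_2 matrix_matrix_mult_def matrix_vector_mult_def sum_2 a_def
  show thesis
  proof
    show "a ** vector [vector [1, 0], vector [0, -1]] = H ** a"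
      using Hu Hv by (simp add: s)
    show "a ** vector [vector [0, 1], vector [0, 0]] = E ** a"
      using Eu Ev by (simp add: s)
    show "a ** vector [vector [0, 0], vector [1, 0]] = F ** a"
      using Fv v_def by (simp add: s)
    show "det a \<noteq> 0"
    proof
      assume "det a = 0"
      then have d: "u$1 * v$2 = u$2 * v$1" by (simp add: det_2 a_def algebra_simps)
      \<comment> \<open>Multiply the entries of \<open>E *v v = u\<close> by \<open>u$1\<close> and
        \<open>u$2\<close>. By \<open>d\<close> the left sides become \<open>v$1\<close> and
        \<open>v$2\<close> times the entries of \<open>E *v u\<close>, which vanish.\<close>
      have "u$1 * u$1 = 0" "u$2 * u$2 = 0"
        using d Eu Ev by (simp_all add: s) algebra+
      then have "u = 0" by (simp add: vec_eq_iff forall_2)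
      then show False using j u_def by simp
    qed
  qed
qed

section \<open>Conjugacy of trace-free triples with equal traces\<close>

lemma trace_comb_0: "\<forall>i. trace (A$i) = 0 \<Longrightarrow> trace (comb p A) = 0"
  by (simp add: comb_def tracefree_entry trace_def sum_2 mscale_def)

lemma comb_lin:
  "comb (x *s p + y *s q + z *s r) A = x *\<^sub>C comb p A + y *\<^sub>C comb q A + z *\<^sub>C comb r A"
  by (simp add: comb_def mscale_def vec_eq_iff algebra_simps)

lemma coord_lin:
  "coord A (x *\<^sub>C P + y *\<^sub>C Q + z *\<^sub>C R) = x *s coord A P + y *s coord A Q + z *s coord A R"
  by (simp add: coord_def mat2_simps forall_3 divide_simps) (simp add: algebra_simps)

lemma coord_basis:
  assumes A: "\<forall>i. trace (A$i) = 0" and s: "trace (A$1 ** A$2 ** A$3) \<noteq> 0"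
  shows "coord A (A$i) = axis i 1"
proof -
  note e = tracefree_entry[OF A[rule_format, of 1]] tracefree_entry[OF A[rule_format, of 2]]
     tracefree_entry[OF A[rule_format, of 3]]
  let ?t = "\<lambda>i j k. trace (A$i ** A$j ** A$k)"
  have "?t 2 3 1 = ?t 1 2 3" "?t 3 1 2 = ?t 1 2 3"
    "?t 1 3 1 = 0" "?t 1 1 2 = 0" "?t 2 2 3 = 0" "?t 2 1 2 = 0" "?t 3 2 3 = 0" "?t 3 3 1 = 0"
    by (simp_all add: mat2_simps e algebra_simps)
  then show ?thesis using s exhaust_3[of i]
    by (auto simp: coord_def vec_eq_iff forall_3 axis_def)
qed

lemma comb_axis: "comb (axis i 1) A = A$i"
  using exhaust_3[of i] by (auto simp: comb_def mscale_def vec_eq_iff axis_def)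

text \<open>The conclusion is an intertwining relation, which is linear in the triple: it extends
  from the images of H, E, F and survives rescaling of \<open>a\<close>.\<close>

lemma tracefree_triples_conjugate:
  fixes A B :: "cmat2^3"
  assumes A: "\<forall>i. trace (A$i) = 0" and B: "\<forall>i. trace (B$i) = 0"
    and tr2: "\<forall>i j. trace (A$i ** A$j) = trace (B$i ** B$j)"
    and tr3: "trace (A$1 ** A$2 ** A$3) = trace (B$1 ** B$2 ** B$3)"
    and s: "trace (A$1 ** A$2 ** A$3) \<noteq> 0"
  obtains a where "a \<in> SL2" "\<And>i. a ** A$i = B$i ** a"
proof -
  \<comment> \<open>On trace-free matrices this is the linear map sending each \<open>A$i\<close> to
    \<open>B$i\<close>.\<close>
  define \<phi> where "\<phi> Z = comb (coord A Z) B" for Z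
  define H E F :: cmat2 where "H = vector [vector [1, 0], vector [0, -1]]"
    and "E = vector [vector [0, 1], vector [0, 0]]"
    and "F = vector [vector [0, 0], vector [1, 0]]"
  note HEF = H_def E_def F_def
  have cc: "comb (coord A Z) A = Z" if "trace Z = 0" for Z
    using comb_coord[OF A that s] .
  have \<phi>0: "trace (\<phi> Z) = 0" for Z
    by (simp add: \<phi>_def trace_comb_0 B)
  have \<phi>2: "trace (\<phi> Z ** \<phi> W) = trace (Z ** W)" if "trace Z = 0" "trace W = 0" for Z W
    using trace_comb[of "coord A Z" A "coord A W"] trace_comb[of "coord A Z" B "coord A W"]
    by (simp add: \<phi>_def cc that tr2)
  have \<phi>3: "trace (\<phi> Z ** \<phi> W ** \<phi> V) = trace (Z ** W ** V)"
    if "trace Z = 0" "trace W = 0" "trace V = 0" for Z W V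
    using trace_comb3[OF A, of "coord A Z" "coord A W" "coord A V"]
      trace_comb3[OF B, of "coord A Z" "coord A W" "coord A V"]
    by (simp add: \<phi>_def cc that tr3)
  have t: "trace H = 0" "trace E = 0" "trace F = 0"
    by (simp_all add: HEF trace_def sum_2)
  obtain a where a: "det a \<noteq> 0" "a ** H = \<phi> H ** a" "a ** E = \<phi> E ** a" "a ** F = \<phi> F ** a"
    unfolding HEF
    apply (rule sl2_intertwiner[of "\<phi> H" "\<phi> E" "\<phi> F"])
    by (simp_all add: \<phi>0 \<phi>2 \<phi>3 t) (simp_all add: HEF mat2_simps)
  have int: "a ** A$i = B$i ** a" for i
  proof -
    let ?x = "A$i$1$1" and ?y = "A$i$1$2" and ?z = "A$i$2$1"
    have Ai: "A$i = ?x *\<^sub>C H + ?y *\<^sub>C E + ?z *\<^sub>C F"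
      using tracefree_entry[OF A[rule_format, of i]] by (simp add: HEF mat2_simps)
    have "B$i = \<phi> (A$i)" by (simp add: \<phi>_def coord_basis A s comb_axis)
    also have "\<dots> = ?x *\<^sub>C \<phi> H + ?y *\<^sub>C \<phi> E + ?z *\<^sub>C \<phi> F"
      by (subst Ai) (simp only: \<phi>_def coord_lin comb_lin)
    finally have Bi: "B$i = ?x *\<^sub>C \<phi> H + ?y *\<^sub>C \<phi> E + ?z *\<^sub>C \<phi> F" .
    have lin: "M ** (p *\<^sub>C P + q *\<^sub>C Q + r *\<^sub>C R) = p *\<^sub>C (M ** P) + q *\<^sub>C (M ** Q) + r *\<^sub>C (M ** R)"
      "(p *\<^sub>C P + q *\<^sub>C Q + r *\<^sub>C R) ** M = p *\<^sub>C (P ** M) + q *\<^sub>C (Q ** M) + r *\<^sub>C (R ** M)"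
      for p q r M P Q R by (simp_all add: mat2_simps algebra_simps)
    show ?thesis by (subst Ai, subst Bi) (simp only: lin a)
  qed
  \<comment> \<open>The determinant is quadratic in a scalar factor, so this factor normalizes it to
    1.\<close>
  let ?c = "1 / csqrt (det a)"
  have "det (?c *\<^sub>C a) = (1 / (csqrt (det a))^2) * det a"
    by (simp add: det_2 mscale_def power2_eq_square diff_divide_distrib)
  then have "?c *\<^sub>C a \<in> SL2" using a(1) by (simp add: SL2_def)
  moreover have "(?c *\<^sub>C a) ** A$i = B$i ** (?c *\<^sub>C a)" for i
  proof -
    have "(?c *\<^sub>C a) ** A$i = ?c *\<^sub>C (a ** A$i)" "B$i ** (?c *\<^sub>C a) = ?c *\<^sub>C (B$i ** a)"
      by (simp_all add: mat2_simps algebra_simps add_divide_distrib)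
    then show ?thesis by (simp add: int)
  qed
  ultimately show thesis using that by blast
qed

section \<open>Trace-free parts of matrices in \<open>G t\<close>, and uniqueness of the
  triple\<close>

lemma tftrace2: "tftrace [x, y] = trace (tracefree x ** tracefree y)"
  by (simp add: tftrace_def)

lemma tftrace3: "tftrace [x, y, z] = trace (tracefree x ** tracefree y ** tracefree z)"
  by (simp add: tftrace_def matrix_mul_assoc)

lemma trace_tracefree: "trace (tracefree x) = 0"
  by (simp add: tracefree_def mat2_simps)

text \<open>The square of the trace-free part has trace tr(x)^2 / 2 - 2 det(x), so once the trace is
  fixed, determinant 1 becomes a condition on this value.\<close>

lemma G_iff: "x \<in> G t \<longleftrightarrow> trace x = t \<and> tftrace [x, x] = t^2 / 2 - 2"
proof -
  have "2 * (trace (tracefree x ** tracefree x) + 2 * det x) = (trace x)^2"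
    by (simp add: tracefree_def mat2_simps det_2 field_simps power2_eq_square)
  then have "trace (tracefree x ** tracefree x) = (trace x)^2 / 2 - 2 * det x"
    by (simp add: field_simps)
  then show ?thesis by (auto simp: G_def SL2_def tftrace2)
qed

lemma lift_tracefree:
  assumes "trace Z = 0"
  shows "tracefree (Z + (t / 2) *\<^sub>C mat 1) = Z" "trace (Z + (t / 2) *\<^sub>C mat 1) = t"
  using tracefree_entry[OF assms] by (simp_all add: tracefree_def mat2_simps)

lemma matrix_inv_right:
  fixes A :: "'a::semiring_1^'n^'m"
  assumes "invertible A"
  shows "A ** matrix_inv A = mat 1"
  using assms unfolding invertible_def matrix_inv_def by (rule someI2_ex) simp

text \<open>Scalar matrices commute with \<open>a\<close>, so with equal traces only the trace-free
  parts need to be intertwined.\<close>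

lemma sim_conjI:
  assumes a: "a \<in> SL2" and tr: "\<And>i. trace (x$i) = trace (y$i)"
    and int: "\<And>i. a ** tracefree (x$i) = tracefree (y$i) ** a"
  shows "sim_conj x y"
proof -
  have inv: "invertible a" using a by (simp add: SL2_def invertible_det_nz)
  have "a ** (c *\<^sub>C mat 1) = (c *\<^sub>C mat 1) ** a" for c
    by (simp add: mat2_simps)
  then have "a ** x$i = y$i ** a" for i
    using int[of i] tr[of i] by (simp add: tracefree_def mat2_diff)
  then have "y$i = a ** x$i ** matrix_inv a" for i
    using matrix_inv_right[OF inv] by (simp add: matrix_mul_assoc[symmetric])
  then show ?thesis using a unfolding sim_conj_def by blast
qed

lemma realizes_sim_conj:
  assumes "realizes t S s123 x" "realizes t S s123 y" "s123 \<noteq> 0"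
  shows "sim_conj x y"
proof -
  define A B :: "cmat2^3" where "A = (\<chi> i. tracefree (x$i))" and "B = (\<chi> i. tracefree (y$i))"
  obtain a where "a \<in> SL2" "\<And>i. a ** A$i = B$i ** a"
    apply (rule tracefree_triples_conjugate[of A B])
    using assms by (auto simp: A_def B_def trace_tracefree realizes_def tftrace2 tftrace3)
  then show ?thesis
    using assms by (intro sim_conjI[of a]) (auto simp: A_def B_def realizes_def G_def)
qed

section \<open>Existence of a triple with prescribed traces\<close>

(* Take A1 diagonal if s0 is nonzero and nilpotent otherwise; this determines the diagonals (resp.
   one off-diagonal entry) of A2 and A3, and leaves a quadratic equation for the rest. *)
lemma gram_tracefree_exists:
  fixes S :: "complex^3^3"
  assumes sym: "\<forall>i j. S$i$j = S$j$i" and diag: "\<forall>i. S$i$i = s0" and det: "det S \<noteq> 0"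
  obtains A :: "cmat2^3" where "\<forall>i. trace (A$i) = 0" "\<forall>i j. trace (A$i ** A$j) = S$i$j"
proof -
  note goal = that
  have S: "S$2$1 = S$1$2" "S$3$1 = S$1$3" "S$3$2 = S$2$3" using sym by blast+
  define M :: "complex \<Rightarrow> complex \<Rightarrow> complex \<Rightarrow> cmat2"
    where "M a b c = vector [vector [a, b], vector [c, -a]]" for a b c
  have Mtr: "trace (M a b c) = 0" "trace (M a b c ** M d e f) = 2 * a * d + b * f + c * e"
    for a b c d e f by (simp_all add: M_def mat2_simps)
  have *: ?thesis
    if "2 * a1^2 + 2 * b1 * c1 = s0" "2 * a2^2 + 2 * b2 * c2 = s0" "2 * a3^2 + 2 * b3 * c3 = s0"
      "2 * a1 * a2 + b1 * c2 + c1 * b2 = S$1$2" "2 * a1 * a3 + b1 * c3 + c1 * b3 = S$1$3"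
      "2 * a2 * a3 + b2 * c3 + c2 * b3 = S$2$3"
    for a1 b1 c1 a2 b2 c2 a3 b3 c3
    apply (rule goal[of "vector [M a1 b1 c1, M a2 b2 c2, M a3 b3 c3]"])
    using that diag S by (auto simp: forall_3 Mtr power2_eq_square algebra_simps)
  show thesis
  proof (cases "s0 = 0")
    case True
    \<comment> \<open>With zero diagonal the determinant is twice the product of the three
      off-diagonal entries.\<close>
    then have nz: "S$1$2 \<noteq> 0" using det diag S by (auto simp: det_3)
    \<comment> \<open>Pairing with \<open>M 0 1 0\<close> reads off lower left entries. Taking the
      second matrix as \<open>M 0 0 (S$1$2)\<close>, the entry \<open>S$2$3\<close> fixes the upper
      right entry of the third, and its vanishing square trace fixes \<open>d\<close>.\<close>
    define d where "d = csqrt (- (S$2$3 / S$1$2 * S$1$3))"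
    have "d^2 = - (S$2$3 / S$1$2 * S$1$3)" by (simp add: d_def)
    then show thesis using nz True
      by (intro *[of 0 1 0 0 0 "S$1$2" d "S$2$3 / S$1$2" "S$1$3"]) auto
  next
    case False
    define r where "r = csqrt (s0 / 2)"
    have r: "2 * r^2 = s0" by (simp add: r_def)
    then have rnz: "r \<noteq> 0" using False by auto
    define a d where "a = S$1$2 / (2 * r)" and "d = S$1$3 / (2 * r)"
    define \<beta> q p where "\<beta> = s0 / 2 - a^2" and "q = s0 / 2 - d^2" and "p = S$2$3 - 2 * a * d"
    have ad: "2 * r * a = S$1$2" "2 * r * d = S$1$3" using rnz by (simp_all add: a_def d_def)
    \<comment> \<open>Pairing with \<open>M r 0 0\<close> forces the diagonals \<open>a\<close> and
      \<open>d\<close>; three equations for the off-diagonal entries remain.\<close>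
    have **: thesis if "b * c = \<beta>" "e * f = q" "b * f + c * e = p" for b c e f
      by (rule *[of r 0 0 a b c d e f]) (use that r ad in \<open>simp_all add: \<beta>_def q_def p_def algebra_simps\<close>)
    consider "\<beta> \<noteq> 0" | "\<beta> = 0" "p \<noteq> 0" | "\<beta> = 0" "p = 0" by blast
    then show thesis
    proof cases
      case 1
      \<comment> \<open>With \<open>b = 1\<close> and \<open>c = \<beta>\<close> the last equation
        gives \<open>f = p - \<beta> * e\<close>, and the middle one becomes the quadratic
        \<open>\<beta> * e^2 - p * e + q = 0\<close>.\<close>
      define w where "w = csqrt (p^2 - 4 * \<beta> * q)"
      have w: "w^2 = p^2 - 4 * \<beta> * q" by (simp add: w_def)
      define e where "e = (p + w) / (2 * \<beta>)"
      have e: "2 * \<beta> * e = p + w" using 1 by (simp add: e_def)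
      have "4 * \<beta> * (e * (p - \<beta> * e)) = 4 * \<beta> * q" using w e by algebra
      then show thesis using 1 by (intro **[of 1 \<beta> e "p - \<beta> * e"]) auto
    next
      case 2
      then show thesis by (intro **[of 1 0 "q / p" p]) auto
    next
      case 3
      then show thesis by (intro **[of 0 0 1 q]) auto
    qed
  qed
qed

lemma realizes_exists:
  fixes S :: "complex^3^3"
  assumes sym: "\<forall>i j. S$i$j = S$j$i" and diag: "\<forall>i. S$i$i = t^2 / 2 - 2"
    and s: "s123 \<noteq> 0" "2 * s123^2 + det S = 0"
  obtains x where "realizes t S s123 x"
proof -
  have "det S \<noteq> 0" using s by auto
  then obtain A :: "cmat2^3" where A: "\<forall>i. trace (A$i) = 0" "\<forall>i j. trace (A$i ** A$j) = S$i$j"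
    using gram_tracefree_exists[OF sym diag] by blast
  have "2 * trace (A$1 ** A$2 ** A$3)^2 + det S = 0"
    using gram_det_tracefree[OF A(1)] by (simp add: A(2))
  then have "trace (A$1 ** A$2 ** A$3)^2 = s123^2" using s by algebra
  then have pm: "trace (A$1 ** A$2 ** A$3) = s123 \<or> trace (A$1 ** A$2 ** A$3) = - s123"
    by (simp add: power2_eq_iff)
  \<comment> \<open>Negating all three matrices keeps the pairwise traces and flips the sign of the
    triple trace.\<close>
  define B where "B = (if trace (A$1 ** A$2 ** A$3) = s123 then A else - A)"
  have B: "\<forall>i. trace (B$i) = 0" "\<forall>i j. trace (B$i ** B$j) = S$i$j"
    "trace (B$1 ** B$2 ** B$3) = s123"
    using A pm by (auto simp: B_def mat2_neg trace_def sum_negf)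
  have "realizes t S s123 (\<chi> i. B$i + (t / 2) *\<^sub>C mat 1)"
    using B diag by (auto simp: realizes_def G_iff tftrace2 tftrace3 lift_tracefree)
  then show thesis by (rule that)
qed

section \<open>The fourth matrix\<close>

text \<open>The values \<open>s124\<close>, \<open>s134\<close>, \<open>s234\<close> are, up to
  sign, the Cramer numerators of the trace-free part of \<open>x4\<close>, hence determine it.
  Conversely, the four equations say that \<open>Z\<close> has the required traces with the given
  triple and with itself.\<close>

lemma realizes_extension_iff:
  assumes x: "realizes t S s123 x" and s: "s123 \<noteq> 0"
    and eqs: "S$1$1 * s234 - S$1$2 * s134 + S$1$3 * s124 - s14 * s123 = 0"
      "S$2$1 * s234 - S$2$2 * s134 + S$2$3 * s124 - s24 * s123 = 0"
      "S$3$1 * s234 - S$3$2 * s134 + S$3$3 * s124 - s34 * s123 = 0"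
      "s14 * s234 - s24 * s134 + s34 * s124 - (t^2 / 2 - 2) * s123 = 0"
  defines "Z \<equiv> (s234 / s123) *\<^sub>C tracefree (x$1) - (s134 / s123) *\<^sub>C tracefree (x$2)
                 + (s124 / s123) *\<^sub>C tracefree (x$3)"
  shows "x4 \<in> G t \<and>
         tftrace [x$1, x4] = s14 \<and> tftrace [x$2, x4] = s24 \<and>
         tftrace [x$3, x4] = s34 \<and> tftrace [x4, x4] = t^2 / 2 - 2 \<and>
         tftrace [x$1, x$2, x4] = s124 \<and> tftrace [x$1, x$3, x4] = s134 \<and>
         tftrace [x$2, x$3, x4] = s234
     \<longleftrightarrow> x4 = Z + (t / 2) *\<^sub>C mat 1"
    (is "?P x4 \<longleftrightarrow> _")
proof -
  define A :: "cmat2^3" where "A = (\<chi> i. tracefree (x$i))"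
  \<comment> \<open>The middle sign comes from alternation: tr(A1 A3 W) = - tr(W A3 A1).\<close>
  define p :: "complex^3" where "p = vector [s234 / s123, - s134 / s123, s124 / s123]"
  have Z: "Z = comb p A"
    by (simp add: Z_def comb_def p_def A_def mscale_def vec_eq_iff)
  have A: "\<forall>i. trace (A$i) = 0" "trace (A$1 ** A$2 ** A$3) = s123"
    and S: "\<And>i j. trace (A$i ** A$j) = S$i$j"
    using x by (auto simp: A_def trace_tracefree realizes_def tftrace2 tftrace3)
  have tZ: "trace Z = 0" by (simp add: Z trace_comb_0 A)
  have e1: "trace (comb (axis i 1) A ** Z) = S$i$1 * (s234 / s123) - S$i$2 * (s134 / s123) + S$i$3 * (s124 / s123)" for i
    using exhaust_3[of i] unfolding Z trace_comb by (auto simp: S sum_3 p_def axis_def mult_ac)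
  have e2: "trace (A$1 ** Z) = s14" "trace (A$2 ** Z) = s24" "trace (A$3 ** Z) = s34"
    using e1[of 1] e1[of 2] e1[of 3] s eqs(1-3) by (auto simp: comb_axis field_simps)
  have "trace (Z ** Z) = p$1 * trace (A$1 ** Z) + p$2 * trace (A$2 ** Z) + p$3 * trace (A$3 ** Z)"
    by (simp add: Z comb_def mat2_simps algebra_simps)
  also have "\<dots> = t^2 / 2 - 2" using eqs(4) s by (simp add: e2 p_def) (simp add: field_simps)
  finally have e3: "trace (Z ** Z) = t^2 / 2 - 2" .
  \<comment> \<open>The determinants with two unit vectors and \<open>p\<close> as rows are
    \<open>p$3\<close>, \<open>- p$2\<close> and \<open>p$1\<close>.\<close>
  have e4: "trace (A$1 ** A$2 ** Z) = s124" "trace (A$1 ** A$3 ** Z) = s134" "trace (A$2 ** A$3 ** Z) = s234"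
    using trace_comb3[OF A(1), of "axis 1 1" "axis 2 1" p, unfolded comb_axis]
      trace_comb3[OF A(1), of "axis 1 1" "axis 3 1" p, unfolded comb_axis]
      trace_comb3[OF A(1), of "axis 2 1" "axis 3 1" p, unfolded comb_axis] s
    by (simp_all add: Z A(2) det_3 p_def axis_def)
  show ?thesis
  proof
    assume "x4 = Z + (t / 2) *\<^sub>C mat 1"
    then show "?P x4"
      using e2 e3 e4 by (simp add: G_iff tftrace2 tftrace3 lift_tracefree tZ A_def)
  next
    assume P: "?P x4"
    define W where "W = tracefree x4"
    have tW: "trace W = 0" by (simp add: W_def trace_tracefree)
    note e = tracefree_entry[OF A(1)[rule_format, of 1]] tracefree_entry[OF A(1)[rule_format, of 2]]
      tracefree_entry[OF A(1)[rule_format, of 3]] tracefree_entry[OF tW]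
    have "trace (W ** A$2 ** A$3) = trace (A$2 ** A$3 ** W)"
      "trace (W ** A$3 ** A$1) = - trace (A$1 ** A$3 ** W)"
      "trace (W ** A$1 ** A$2) = trace (A$1 ** A$2 ** W)"
      by (simp_all add: mat2_simps e algebra_simps)
    then have "coord A W = p" using P s
      by (simp add: coord_def p_def A(2) vec_eq_iff forall_3)
        (simp add: A_def W_def tftrace3)
    then have "W = Z" using comb_coord[OF A(1) tW] A(2) s by (simp add: Z)
    then show "x4 = Z + (t / 2) *\<^sub>C mat 1"
      using P by (auto simp: W_def tracefree_def G_def)
  qed
qed

theorem lemma2p3:
  fixes t s0 :: complex
  assumes s0: "s0 = t^2 / 2 - 2"
  shows
    "(\<forall>(S :: complex^3^3) (s123 :: complex).
        (\<forall>i j. S$i$j = S$j$i) \<and> (\<forall>i. S$i$i = s0) \<and>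
        s123 \<noteq> 0 \<and> 2 * s123^2 + det S = 0 \<longrightarrow>
        (\<exists>x. realizes t S s123 x \<and> (\<forall>y. realizes t S s123 y \<longrightarrow> sim_conj x y)))
     \<and>
     (\<forall>(S :: complex^3^3) (s123 :: complex) (x :: cmat2^3)
        (s14 :: complex) (s24 :: complex) (s34 :: complex) (s44 :: complex)
        (s124 :: complex) (s134 :: complex) (s234 :: complex).
        realizes t S s123 x \<and> s123 \<noteq> 0 \<and> s44 = s0 \<and>
        S$1$1 * s234 - S$1$2 * s134 + S$1$3 * s124 - s14 * s123 = 0 \<and>
        S$2$1 * s234 - S$2$2 * s134 + S$2$3 * s124 - s24 * s123 = 0 \<and>
        S$3$1 * s234 - S$3$2 * s134 + S$3$3 * s124 - s34 * s123 = 0 \<and>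
        s14 * s234 - s24 * s134 + s34 * s124 - s44 * s123 = 0 \<longrightarrow>
        (let P = (\<lambda>x4. x4 \<in> G t \<and>
               tftrace [x$1, x4] = s14 \<and> tftrace [x$2, x4] = s24 \<and>
               tftrace [x$3, x4] = s34 \<and> tftrace [x4, x4] = s44 \<and>
               tftrace [x$1, x$2, x4] = s124 \<and> tftrace [x$1, x$3, x4] = s134 \<and>
               tftrace [x$2, x$3, x4] = s234)
         in (\<exists>!x4. P x4) \<and>
            (\<forall>x4. P x4 \<longrightarrow>
               tracefree x4 = (s234 / s123) *\<^sub>C tracefree (x$1)
                 - (s134 / s123) *\<^sub>C tracefree (x$2)
                 + (s124 / s123) *\<^sub>C tracefree (x$3))))"
proof (intro conjI allI impI, goal_cases)
  case (1 S s123)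
  then obtain x where "realizes t S s123 x"
    using realizes_exists[of S t s123] by (auto simp: s0)
  then show ?case using 1 realizes_sim_conj by blast
next
  case (2 S s123 x s14 s24 s34 s44 s124 s134 s234)
  let ?Z = "(s234 / s123) *\<^sub>C tracefree (x$1) - (s134 / s123) *\<^sub>C tracefree (x$2)
    + (s124 / s123) *\<^sub>C tracefree (x$3)"
  have tZ: "trace ?Z = 0"
    using trace_tracefree[THEN tracefree_entry] by (simp add: mscale_def trace_def sum_2)
  have iff: "x4 \<in> G t \<and>
         tftrace [x$1, x4] = s14 \<and> tftrace [x$2, x4] = s24 \<and>
         tftrace [x$3, x4] = s34 \<and> tftrace [x4, x4] = s44 \<and>
         tftrace [x$1, x$2, x4] = s124 \<and> tftrace [x$1, x$3, x4] = s134 \<and>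
         tftrace [x$2, x$3, x4] = s234
     \<longleftrightarrow> x4 = ?Z + (t / 2) *\<^sub>C mat 1" for x4
    using 2 realizes_extension_iff[of t S s123 x s234 s134 s124 s14 s24 s34 x4] by (auto simp: s0)
  \<comment> \<open>The conditions on \<open>x4\<close> have become equality with an explicit
    matrix, so unique existence is immediate.\<close>
  show ?case unfolding Let_def iff by (simp add: lift_tracefree[OF tZ])
qed

end
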